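(* Let $F=F(m,k_1,\ldots,k_\nu)$ be a solvable summand of the colored Jones polynomial $J_n(K;q)$ of a hyperbolic knot $K$ ($n=2m+1$), and let $R,S,R_j,S_j$ be the polynomials representing the ratios $EF/F=R/S$ and $E_jF/F=R_j/S_j$ ($j=1,\ldots,\nu$) after the substitution $q^{k_i}=Q_i$, $q^m=Q_{(0)}$. Then the polynomial $a_F(l,\alpha)$ is obtained by taking a generator of the ideal $$\langle \varepsilon(S_1-R_1),\ldots,\varepsilon(S_\nu-R_\nu),\ \varepsilon(S^2E^2-R^2)\rangle\cap\mathbb{Q}(Q_{(0)})[E]$$ in $\mathbb{Q}(Q_{(0)})[E]$ whose coefficients are in $\mathbb{Z}[Q_{(0)}]$ and coprime, and substituting $E=l$ and $Q_{(0)}=\alpha$. Here $\varepsilon$ is evaluation at $q=1$, and $\langle\cdots\rangle$ is the ideal generated in the commutative polynomial ring $\mathbb{Q}(Q_{(0)})[E,Q_1,\ldots,Q_\nu]$.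
   Context: **The summand.** $J_n(K;q)$ is the $n$-th colored Jones polynomial of $K$, normalized by $J_n(\text{unknot};q)=[n]=\frac{q^{n/2}-q^{-n/2}}{q^{1/2}-q^{-1/2}}$. Here $n$ is an integer and $m$ is the half-integer with $n=2m+1$. A summand is a function $F$ with $J_n(K;q)=\sum_{k_1,\ldots,k_\nu}F(m,k_1,\ldots,k_\nu)$ of the form $$F(m,k_1,\ldots,k_\nu)=(-1)^{(e,\tilde k)}\,q^{\frac12\tilde k^\top A\tilde k+(b,\tilde k)+c}\,\frac{\prod_s (q)_{(p_s,\tilde k)+r_s}}{\prod_t (q)_{(p'_t,\tilde k)+r'_t}},$$ where $\tilde k=(m,k_1,\ldots,k_\nu)$, $(\cdot,\cdot)$ is the standard inner product, $e\in\{0,1\}^{\nu+1}$, $A=(a_{ij})_{0\le i,j\le\nu}$ is a symmetric integer matrix, $b\in\mathbb{Q}^{\nu+1}$, $c\in\mathbb{Z}$, $p_s=(p_{s,0},\ldots,p_{s,\nu})$ and $p'_t=(p'_{t,0},\ldots,p'_{t,\nu})$ are in $\mathbb{Z}^{\nu+1}$, $r_s,r'_t\in\mathbb{Z}$, the products are finite, and $(q)_k=(1-q)(1-q^2)\cdots(1-q^k)$. **The potential function.** With $w_0=\alpha$ and $\tilde w^{p}=\alpha^{p_0}w_1^{p_1}\cdots w_\nu^{p_\nu}$, $$\Phi_F(\alpha,w_1,\ldots,w_\nu)=\pi\sqrt{-1}\sum_{i=0}^\nu e_i\log w_i+\frac12\sum_{i,j=0}^\nu a_{ij}\log w_i\log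 w_j+\sum_s\left(-\mathrm{Li}_2(\tilde w^{p_s})+\frac{\pi^2}{6}\right)-\sum_t\left(-\mathrm{Li}_2(\tilde w^{p'_t})+\frac{\pi^2}{6}\right),$$ where $\mathrm{Li}_2(z)=-\int_0^z\frac{\log(1-x)}{x}dx$. **Solvability and $a_F$.** Consider the equations $$\exp\left(w_j\frac{\partial\Phi_F}{\partial w_j}\right)=1\ (j=1,\ldots,\nu),\qquad \exp\left(\alpha\frac{\partial\Phi_F}{\partial\alpha}\right)=l^2 .$$ Their left-hand sides are the rational functions ($j=0,\ldots,\nu$) $$(-1)^{e_j}\prod_{i=0}^{\nu}w_i^{a_{ij}}\prod_s(1-\tilde w^{p_s})^{p_{s,j}}\prod_t(1-\tilde w^{p'_t})^{-p'_{t,j}}=\frac{N_j}{D_j}.$$ The polynomials $N_j,D_j$ are obtained by writing each $1-\tilde w^{p}$ as $(\tilde w^{p^-}-\tilde w^{p^+})/\tilde w^{p^-}$ (with $p^{\pm}$ the entrywise positive/negative parts of $p$), collecting all monomials into one, and putting the factors and variables with positive exponents (and the sign) in $N_j$ and those with negative exponents in $D_j$, with no further cancellation. The equations thus become the algebraic equations $p_0=0,\ p_1=0,\ldots,p_\nu=0$ with coefficients in $\mathbb{Q}(\alpha)$, where (here $p_0,\ldots,p_\nu$ denote polynomials) $p_0=D_0l^2-N_0\in\mathbb{Q}(\alpha)[l,w_1,\ldots,w_\nu]$ and $p_j=D_j-N_j\in\mathbb{Q}(\alpha)[w_1,\ldots,w_\nu]$ for $j\ge1$. The summand $F$ is called solvable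 if this system has solutions (over an algebraic closure of $\mathbb{Q}(\alpha)$). For solvable $F$, $a_F(l,\alpha)$ is the generator of the ideal $\langle p_0,p_1,\ldots,p_\nu\rangle\cap\mathbb{Q}(\alpha)[l]$ of $\mathbb{Q}(\alpha)[l]$ whose coefficients are in $\mathbb{Z}[\alpha]$ and coprime (taken to be $0$ if the ideal is zero); it is defined up to sign. **The $q$-differences.** $E$ shifts $n$ to $n+1$ (i.e. $m$ to $m+\frac12$), and $E_j$ shifts $k_j$ to $k_j+1$. It is assumed that $EF/F$ and $E_jF/F$ are rational functions over $\mathbb{Q}$ in $q,q^m,q^{k_1},\ldots,q^{k_\nu}$. The polynomials $R,S,R_j,S_j\in\mathbb{Q}[q,Q_{(0)},Q_1,\ldots,Q_\nu]$ are defined by $$\left.\frac{EF}{F}\right|_{q^{k_i}=Q_i,\,q^m=Q_{(0)}}=\frac{R}{S},\qquad \left.\frac{E_jF}{F}\right|_{q^{k_i}=Q_i,\,q^m=Q_{(0)}}=\frac{R_j}{S_j},$$ where numerators and denominators are read off from the explicit products of factors $1-q^{h}Q_{(0)}^{u_0}Q_1^{u_1}\cdots Q_\nu^{u_\nu}$, monomials and signs arising from the formula for $F$ (using $(q)_{k+1}/(q)_k=1-q^{k+1}$), by the same convention as for $N_j/D_j$ (no further cancellation; powers of $q$ likewise distributed according to the sign of the exponent). In the ideal, $E$, $Q_{(0)}$ and the $Q_i$ are regarded as commuting variables. *)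

theory Defs
  imports
    "HOL-Analysis.Analysis"
    "HOL-Library.Poly_Mapping"
    "HOL-Computational_Algebra.Computational_Algebra"
    "HOL-Algebra.Algebraic_Closure_Type"
begin

section \<open>Hyperbolic knots\<close>

definition S3 :: "(real^3) option topology" where
  "S3 = Alexandroff_compactification euclidean"

definition knot_complement :: "(real^3) set \<Rightarrow> (real^3) option topology" where
  "knot_complement K = subtopology S3 (topspace S3 - Some ` K)"

text \<open>Hyperbolic 3-space is the upper half-space model.\<close>

definition H3 :: "(real^3) set" where
  "H3 = {x. x $ 3 > 0}"

definition hyp_dist :: "real^3 \<Rightarrow> real^3 \<Rightarrow> real" where
  "hyp_dist x y = arcosh (1 + (dist x y)\<^sup>2 / (2 * x $ 3 * y $ 3))"

definition hyp_isometry :: "(real^3 \<Rightarrow> real^3) \<Rightarrow> bool" where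
  "hyp_isometry f \<longleftrightarrow> bij_betw f H3 H3 \<and> (\<forall>x\<in>H3. \<forall>y\<in>H3. hyp_dist (f x) (f y) = hyp_dist x y)"

text \<open>A group of isometries of hyperbolic space, as maps restricted to \<^term>\<open>H3\<close> (their values
  elsewhere are irrelevant), that acts freely and discontinuously.\<close>

definition hyp_covering_group :: "(real^3 \<Rightarrow> real^3) set \<Rightarrow> bool" where
  "hyp_covering_group G \<longleftrightarrow>
     (\<forall>f\<in>G. hyp_isometry f) \<and>
     (\<exists>e\<in>G. \<forall>x\<in>H3. e x = x) \<and>
     (\<forall>f\<in>G. \<forall>g\<in>G. \<exists>h\<in>G. \<forall>x\<in>H3. h x = f (g x)) \<and>
     (\<forall>f\<in>G. \<exists>h\<in>G. \<forall>x\<in>H3. h (f x) = x) \<and>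
     (\<forall>x\<in>H3. \<exists>U. open U \<and> x \<in> U \<and>
        (\<forall>f\<in>G. (\<exists>y\<in>U \<inter> H3. f y \<in> U) \<longrightarrow> (\<forall>y\<in>H3. f y = y)))"

definition finite_covolume :: "(real^3 \<Rightarrow> real^3) set \<Rightarrow> bool" where
  "finite_covolume G \<longleftrightarrow>
     (\<exists>D\<in>sets borel. D \<subseteq> H3 \<and> H3 \<subseteq> (\<Union>f\<in>G. f ` D) \<and>
        (\<integral>\<^sup>+x\<in>D. ennreal (1 / (x $ 3) ^ 3) \<partial>lborel) < \<infinity>)"

text \<open>The complement in the 3-sphere is homeomorphic to a quotient \<open>H3 / G\<close> of finite volume, i.e.\
  it carries a complete hyperbolic metric of finite volume. The homeomorphism is expressed by a
  quotient map whose fibres are the orbits.\<close>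

definition hyperbolic_complement :: "(real^3) set \<Rightarrow> bool" where
  "hyperbolic_complement K \<longleftrightarrow>
     (\<exists>G \<pi>. hyp_covering_group G \<and> finite_covolume G \<and>
        quotient_map (top_of_set H3) (knot_complement K) \<pi> \<and>
        (\<forall>x\<in>H3. \<forall>y\<in>H3. \<pi> x = \<pi> y \<longleftrightarrow> (\<exists>f\<in>G. f x = y)))"

text \<open>A letter \<open>(i, s)\<close> of a braid word on strands \<open>0, \<dots>, N - 1\<close> is the crossing of the strands in
  positions \<open>i\<close> and \<open>i + 1\<close>; it is positive iff \<open>s\<close>.\<close>

type_synonym braid_word = "(nat \<times> bool) list"

definition braid_word_on :: "nat \<Rightarrow> braid_word \<Rightarrow> bool" where
  "braid_word_on N w \<longleftrightarrow> (\<forall>(i, s)\<in>set w. Suc i < N)"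

text \<open>The closed braid winds counterclockwise around the third axis: the strand in position \<open>p\<close> runs
  at distance \<open>p + 1\<close> from the axis, and the \<open>l\<close>-th letter occupies the \<open>l\<close>-th of \<open>length w\<close> equal
  angular sectors. In a positive crossing the strand that moves outwards passes above the other
  one. The empty word is not represented (it gives the empty set).\<close>

definition cyl :: "real \<Rightarrow> real \<Rightarrow> real \<Rightarrow> real^3" where
  "cyl \<rho> \<theta> z = vector [\<rho> * cos \<theta>, \<rho> * sin \<theta>, z]"

definition strand_point :: "nat \<times> bool \<Rightarrow> nat \<Rightarrow> real \<Rightarrow> real \<Rightarrow> real^3" where
  "strand_point c p t \<theta> =
     (let i = fst c; h = (if snd c then 1 else -1) * sin (pi * t) in
      if p = i then cyl (real p + 1 + t) \<theta> h
      else if p = Suc i then cyl (real p + 1 - t) \<theta> (- h)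
      else cyl (real p + 1) \<theta> 0)"

definition closed_braid :: "nat \<Rightarrow> braid_word \<Rightarrow> (real^3) set" where
  "closed_braid N w =
     {strand_point (w ! l) p t (2 * pi * (real l + t) / real (length w)) | l p t.
        l < length w \<and> p < N \<and> 0 \<le> t \<and> t \<le> 1}"

definition ambient_isotopic :: "(real^3) set \<Rightarrow> (real^3) set \<Rightarrow> bool" where
  "ambient_isotopic C K \<longleftrightarrow>
     (\<exists>h :: real \<Rightarrow> real^3 \<Rightarrow> real^3.
        continuous_on ({0..1} \<times> UNIV) (\<lambda>(t, x). h t x) \<and>
        (\<forall>t\<in>{0..1}. \<exists>g. homeomorphism UNIV UNIV (h t) g) \<and>
        h 0 = id \<and> h 1 ` C = K)"

definition braid_presents :: "nat \<Rightarrow> braid_word \<Rightarrow> (real^3) set \<Rightarrow> bool" where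
  "braid_presents N w K \<longleftrightarrow> braid_word_on N w \<and> ambient_isotopic (closed_braid N w) K"

text \<open>By Alexander's theorem the second condition says that \<open>K\<close> is tame.\<close>

definition knot :: "(real^3) set \<Rightarrow> bool" where
  "knot K \<longleftrightarrow> K homeomorphic sphere (0::complex) 1 \<and> (\<exists>N w. braid_presents N w K)"

definition hyperbolic_knot :: "(real^3) set \<Rightarrow> bool" where
  "hyperbolic_knot K \<longleftrightarrow> knot K \<and> hyperbolic_complement K"


section \<open>The colored Jones polynomial\<close>

text \<open>A Kauffman state of a closed braid chooses for every letter either the identity smoothing
  (\<open>True\<close>) or the cup-cap smoothing (\<open>False\<close>). The strand ends are the points \<open>(p, l)\<close> with \<open>p < N\<close>
  and \<open>l \<le> length w\<close>; closing up joins level \<open>length w\<close> to level 0.\<close>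

definition state_edges :: "nat \<Rightarrow> braid_word \<Rightarrow> bool list \<Rightarrow> ((nat \<times> nat) \<times> (nat \<times> nat)) set" where
  "state_edges N w s =
     {((p, length w), (p, 0)) | p. p < N} \<union>
     {((p, l), (p, Suc l)) | p l. p < N \<and> l < length w \<and>
        (s ! l \<or> (p \<noteq> fst (w ! l) \<and> p \<noteq> Suc (fst (w ! l))))} \<union>
     {((fst (w ! l), l), (Suc (fst (w ! l)), l)) | l. l < length w \<and> \<not> s ! l} \<union>
     {((fst (w ! l), Suc l), (Suc (fst (w ! l)), Suc l)) | l. l < length w \<and> \<not> s ! l}"

definition state_loops :: "nat \<Rightarrow> braid_word \<Rightarrow> bool list \<Rightarrow> nat" where
  "state_loops N w s =
     card (({..<N} \<times> {..length w}) // (state_edges N w s \<union> (state_edges N w s)\<inverse>)\<^sup>*)"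

text \<open>Unnormalized Kauffman bracket of the closed braid diagram: the empty diagram has value 1 and a
  circle has value \<open>- A^2 - A^(-2)\<close>.\<close>

definition kauffman_bracket :: "real \<Rightarrow> nat \<Rightarrow> braid_word \<Rightarrow> real" where
  "kauffman_bracket A N w =
     (\<Sum>s\<in>{s. length s = length w}.
        (\<Prod>l<length w. if s ! l = snd (w ! l) then A else inverse A) *
        (- (A ^ 2) - inverse A ^ 2) ^ state_loops N w s)"

text \<open>The blackboard \<open>r\<close>-parallel; it lives on \<open>r * N\<close> strands.\<close>

definition cable :: "nat \<Rightarrow> braid_word \<Rightarrow> braid_word" where
  "cable r w =
     concat (map (\<lambda>(i, s).
       concat (map (\<lambda>a. map (\<lambda>b. (r * i + (r - 1 - a) + b, s)) [0..<r]) [0..<r])) w)"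

definition writhe :: "braid_word \<Rightarrow> int" where
  "writhe w = (\<Sum>(i, s)\<leftarrow>w. if s then 1 else -1)"

text \<open>The value at \<open>q\<close> of the \<open>n\<close>-th colored Jones polynomial (\<open>n\<close> is the dimension, \<open>n \<ge> 1\<close>) of the
  closed braid with framing 0. The coloring by \<open>k = n - 1\<close> is the Chebyshev polynomial
  \<open>\<Sum>\<^sub>j (-1)^j (k - j choose j) z^(k - 2 j)\<close> in the core \<open>z\<close> of the annulus, a positive curl
  contributes \<open>(-1)^k A^(k^2 + 2 k)\<close>, and \<open>q = A^(-4)\<close>. The leading sign makes the value of the
  unknot equal to \<open>[n]\<close>.\<close>

definition colored_jones :: "nat \<Rightarrow> braid_word \<Rightarrow> nat \<Rightarrow> real \<Rightarrow> real" where
  "colored_jones N w n q =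
     (let A = q powr (-1/4); k = n - 1 in
      (-1) ^ k * ((-1) ^ k * A ^ (k\<^sup>2 + 2 * k)) powi (- writhe w) *
      (\<Sum>j\<le>k div 2. (-1) ^ j * real ((k - j) choose j) *
         kauffman_bracket A ((k - 2 * j) * N) (cable (k - 2 * j) w)))"


section \<open>Summands\<close>

text \<open>The data of a summand; vectors and matrices are indexed by \<open>0, \<dots>, \<nu>\<close>, and their values at
  larger indices are never used. A pair \<open>(p, r)\<close> stands for the factor \<open>(q)\<^bsub>(p, k) + r\<^esub>\<close>.\<close>

record summand =
  nu :: nat
  sgn_vec :: "nat \<Rightarrow> int"
  quad_mat :: "nat \<Rightarrow> nat \<Rightarrow> int"
  lin_vec :: "nat \<Rightarrow> rat"
  cst :: int
  num_facs :: "((nat \<Rightarrow> int) \<times> int) list"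
  den_facs :: "((nat \<Rightarrow> int) \<times> int) list"

definition well_formed :: "summand \<Rightarrow> bool" where
  "well_formed F \<longleftrightarrow>
     (\<forall>i\<le>nu F. sgn_vec F i \<in> {0, 1}) \<and>
     (\<forall>i\<le>nu F. \<forall>j\<le>nu F. quad_mat F i j = quad_mat F j i)"

definition pair :: "nat \<Rightarrow> (nat \<Rightarrow> int) \<Rightarrow> (nat \<Rightarrow> rat) \<Rightarrow> rat" where
  "pair \<nu> p x = (\<Sum>i\<le>\<nu>. of_int (p i) * x i)"

definition quad_form :: "summand \<Rightarrow> (nat \<Rightarrow> rat) \<Rightarrow> rat" where
  "quad_form F x = (\<Sum>i\<le>nu F. \<Sum>j\<le>nu F. of_int (quad_mat F i j) * x i * x j) / 2
     + (\<Sum>i\<le>nu F. lin_vec F i * x i)"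

definition qfact :: "real \<Rightarrow> int \<Rightarrow> real" where
  "qfact q k = (\<Prod>i=1..nat k. 1 - q ^ i)"

definition index_of :: "summand \<Rightarrow> (nat \<Rightarrow> rat) \<Rightarrow> (nat \<Rightarrow> int) \<times> int \<Rightarrow> rat" where
  "index_of F x = (\<lambda>(p, r). pair (nu F) p x + of_int r)"

definition indices_nonneg :: "summand \<Rightarrow> (nat \<Rightarrow> rat) \<Rightarrow> bool" where
  "indices_nonneg F x \<longleftrightarrow> (\<forall>f\<in>set (num_facs F) \<union> set (den_facs F). index_of F x f \<in> \<nat>)"

definition summand_value :: "summand \<Rightarrow> real \<Rightarrow> (nat \<Rightarrow> rat) \<Rightarrow> complex" where
  "summand_value F q x =
     cis (pi * of_rat (pair (nu F) (sgn_vec F) x)) *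
     of_real (q powr of_rat (quad_form F x + of_int (cst F))) *
     of_real ((\<Prod>f\<leftarrow>num_facs F. qfact q \<lfloor>index_of F x f\<rfloor>) /
              (\<Prod>f\<leftarrow>den_facs F. qfact q \<lfloor>index_of F x f\<rfloor>))"

definition tilde :: "nat \<Rightarrow> (nat \<Rightarrow> int) \<Rightarrow> nat \<Rightarrow> rat" where
  "tilde n k i = (if i = 0 then (of_nat n - 1) / 2 else of_int (k i))"

text \<open>The range of summation \<open>D n\<close> is any finite set on which all the \<open>q\<close>-factorials are defined; a
  tuple \<open>(k\<^sub>1, \<dots>, k\<^sub>\<nu>)\<close> is a function vanishing outside \<open>{1..\<nu>}\<close>. The Laurent polynomials in
  \<open>q^(1/2)\<close> are compared on \<open>0 < q < 1\<close>.\<close>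

definition summand_of_colored_jones :: "summand \<Rightarrow> (real^3) set \<Rightarrow> bool" where
  "summand_of_colored_jones F K \<longleftrightarrow>
     well_formed F \<and>
     (\<exists>N w D. braid_presents N w K \<and>
        (\<forall>n\<ge>1. finite (D n) \<and>
           (\<forall>k\<in>D n. (\<forall>i. i \<notin> {1..nu F} \<longrightarrow> k i = 0) \<and> indices_nonneg F (tilde n k)) \<and>
           (\<forall>q. 0 < q \<and> q < 1 \<longrightarrow>
              of_real (colored_jones N w n q) = (\<Sum>k\<in>D n. summand_value F q (tilde n k)))))"


section \<open>Multivariate polynomials\<close>

type_synonym ('v, 'a) mpol = "('v \<Rightarrow>\<^sub>0 nat) \<Rightarrow>\<^sub>0 'a"

definition mvar :: "'v \<Rightarrow> ('v, 'a::comm_ring_1) mpol" where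
  "mvar v = Poly_Mapping.single (Poly_Mapping.single v 1) 1"

definition mconst :: "'a \<Rightarrow> ('v, 'a::comm_ring_1) mpol" where
  "mconst c = Poly_Mapping.single 0 c"

text \<open>Substitution of \<open>x v\<close> for the variable \<open>v\<close>, with coefficients mapped by \<open>h\<close>.\<close>

definition msubst :: "('a \<Rightarrow> 'b) \<Rightarrow> ('v \<Rightarrow> 'b) \<Rightarrow> ('v, 'a::comm_ring_1) mpol \<Rightarrow> 'b::comm_ring_1" where
  "msubst h x P =
     (\<Sum>t\<in>Poly_Mapping.keys P. h (Poly_Mapping.lookup P t) *
        (\<Prod>v\<in>Poly_Mapping.keys t. x v ^ Poly_Mapping.lookup t v))"

text \<open>Reading off numerator and denominator of
  \<open>(\<Prod>\<^bsub>v \<in> V\<^esub> x\<^sub>v^(u v)) * (\<Prod>\<^bsub>(p, d)\<^esub> (1 - x^p)^d)\<close>: each \<open>1 - x^p\<close> is written as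
  \<open>(x^(p\<^sup>-) - x^(p\<^sup>+)) / x^(p\<^sup>-)\<close>, all monomials are collected into one, and the factors and variables
  are distributed according to the signs of their exponents, without further cancellation.\<close>

definition mono :: "'v set \<Rightarrow> ('v \<Rightarrow> int) \<Rightarrow> ('v, rat) mpol" where
  "mono V u = (\<Prod>v\<in>V. mvar v ^ nat (u v))"

definition collected :: "('v \<Rightarrow> int) \<Rightarrow> (('v \<Rightarrow> int) \<times> int) list \<Rightarrow> 'v \<Rightarrow> int" where
  "collected u fs v = u v - (\<Sum>(p, d)\<leftarrow>fs. d * max 0 (- p v))"

definition binom_fac :: "'v set \<Rightarrow> ('v \<Rightarrow> int) \<Rightarrow> ('v, rat) mpol" where
  "binom_fac V p = mono V (\<lambda>v. - p v) - mono V p"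

definition read_num :: "'v set \<Rightarrow> ('v \<Rightarrow> int) \<Rightarrow> (('v \<Rightarrow> int) \<times> int) list \<Rightarrow> ('v, rat) mpol" where
  "read_num V u fs = mono V (collected u fs) * (\<Prod>(p, d)\<leftarrow>fs. binom_fac V p ^ nat d)"

definition read_den :: "'v set \<Rightarrow> ('v \<Rightarrow> int) \<Rightarrow> (('v \<Rightarrow> int) \<times> int) list \<Rightarrow> ('v, rat) mpol" where
  "read_den V u fs =
     mono V (\<lambda>v. - collected u fs v) * (\<Prod>(p, d)\<leftarrow>fs. binom_fac V p ^ nat (- d))"


section \<open>Elimination over the field of rational functions\<close>

text \<open>\<^typ>\<open>rat poly fract\<close> is the field of rational functions in one variable, \<open>\<alpha>\<close> or \<open>Q\<^sub>(\<^sub>0\<^sub>)\<close>, and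
  \<^typ>\<open>(nat, rat poly fract) mpol\<close> restricted to the variables \<open>0, \<dots>, \<nu>\<close> is the polynomial ring
  over it in \<open>l, w\<^sub>1, \<dots>, w\<^sub>\<nu>\<close> or in \<open>E, Q\<^sub>1, \<dots>, Q\<^sub>\<nu>\<close>: variable 0 is the one that survives the
  elimination.\<close>

definition alpha :: "rat poly fract" where
  "alpha = to_fract [:0, 1:]"

definition rat_const :: "rat \<Rightarrow> (nat, rat poly fract) mpol" where
  "rat_const c = mconst (to_fract [:c:])"

definition mpols :: "nat \<Rightarrow> (nat, rat poly fract) mpol set" where
  "mpols \<nu> = {P. \<forall>t\<in>Poly_Mapping.keys P. Poly_Mapping.keys t \<subseteq> {..\<nu>}}"

definition ideal_gen :: "nat \<Rightarrow> (nat \<Rightarrow> (nat, rat poly fract) mpol) \<Rightarrow> (nat, rat poly fract) mpol set" where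
  "ideal_gen \<nu> P = {\<Sum>j\<le>\<nu>. c j * P j | c. \<forall>j\<le>\<nu>. c j \<in> mpols \<nu>}"

definition elim_ideal :: "nat \<Rightarrow> (nat \<Rightarrow> (nat, rat poly fract) mpol) \<Rightarrow> rat poly fract poly set" where
  "elim_ideal \<nu> P = {f. poly (map_poly mconst f) (mvar 0) \<in> ideal_gen \<nu> P}"

text \<open>In \<^typ>\<open>int poly poly\<close> the outer variable is \<open>l\<close> or \<open>E\<close>, and the inner one is \<open>\<alpha>\<close> or \<open>Q\<^sub>(\<^sub>0\<^sub>)\<close>.
  Hence the substitution \<open>E = l\<close>, \<open>Q\<^sub>(\<^sub>0\<^sub>) = \<alpha>\<close> is the identity on this type.\<close>

definition to_Q_alpha :: "int poly poly \<Rightarrow> rat poly fract poly" where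
  "to_Q_alpha = map_poly (\<lambda>c. to_fract (map_poly of_int c))"

text \<open>\<open>a\<close> generates the ideal \<open>I\<close> and has coprime coefficients (\<open>a = 0\<close> if \<open>I\<close> is zero).\<close>

definition coprime_generator :: "rat poly fract poly set \<Rightarrow> int poly poly \<Rightarrow> bool" where
  "coprime_generator I a \<longleftrightarrow>
     I = {f. to_Q_alpha a dvd f} \<and> (a = 0 \<or> content a = 1)"


section \<open>The polynomial \<open>a\<^sub>F\<close>\<close>

text \<open>Variables \<open>l\<close> and \<open>w\<^sub>0, \<dots>, w\<^sub>\<nu>\<close>, where \<open>w\<^sub>0 = \<alpha>\<close>.\<close>

datatype lvar = L_var | W_var nat

fun w_exps :: "(nat \<Rightarrow> int) \<Rightarrow> lvar \<Rightarrow> int" where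
  "w_exps u L_var = 0"
| "w_exps u (W_var i) = u i"

text \<open>The factors \<open>1 - w^p\<close> of \<open>exp (w\<^sub>j \<partial>\<Phi>/\<partial>w\<^sub>j)\<close> with their exponents.\<close>

definition pot_facs :: "summand \<Rightarrow> nat \<Rightarrow> ((lvar \<Rightarrow> int) \<times> int) list" where
  "pot_facs F j =
     map (\<lambda>(p, r). (w_exps p, p j)) (num_facs F) @
     map (\<lambda>(p, r). (w_exps p, - p j)) (den_facs F)"

definition pot_N :: "summand \<Rightarrow> nat \<Rightarrow> (lvar, rat) mpol" where
  "pot_N F j = (-1) ^ nat (sgn_vec F j) *
     read_num (W_var ` {..nu F}) (w_exps (\<lambda>i. quad_mat F i j)) (pot_facs F j)"

definition pot_D :: "summand \<Rightarrow> nat \<Rightarrow> (lvar, rat) mpol" where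
  "pot_D F j = read_den (W_var ` {..nu F}) (w_exps (\<lambda>i. quad_mat F i j)) (pot_facs F j)"

fun lvar_subst :: "lvar \<Rightarrow> (nat, rat poly fract) mpol" where
  "lvar_subst L_var = mvar 0"
| "lvar_subst (W_var i) = (if i = 0 then mconst alpha else mvar i)"

definition pot_poly :: "summand \<Rightarrow> nat \<Rightarrow> (nat, rat poly fract) mpol" where
  "pot_poly F j = msubst rat_const lvar_subst
     (if j = 0 then pot_D F 0 * mvar L_var ^ 2 - pot_N F 0 else pot_D F j - pot_N F j)"

definition solvable :: "summand \<Rightarrow> bool" where
  "solvable F \<longleftrightarrow>
     (\<exists>x :: nat \<Rightarrow> rat poly fract alg_closure. \<forall>j\<le>nu F. msubst to_ac x (pot_poly F j) = 0)"

text \<open>\<open>a_F\<close> is defined up to sign.\<close>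

definition is_a_F :: "summand \<Rightarrow> int poly poly \<Rightarrow> bool" where
  "is_a_F F = coprime_generator (elim_ideal (nu F) (pot_poly F))"


section \<open>The \<open>q\<close>-differences\<close>

text \<open>The shift of \<open>(m, k\<^sub>1, \<dots>, k\<^sub>\<nu>)\<close> performed by \<open>E\<close> (\<open>j = 0\<close>) and by \<open>E\<^sub>j\<close> (\<open>j \<ge> 1\<close>).\<close>

definition shift :: "nat \<Rightarrow> nat \<Rightarrow> rat" where
  "shift j i = (if i = j then (if j = 0 then 1/2 else 1) else 0)"

text \<open>With \<open>\<delta>\<close> the shift, \<open>Q\<^sub>0 = q^m\<close> and \<open>Q\<^sub>i = q^(k\<^sub>i)\<close>, the shifted summand divided by \<open>F\<close> is the sign
  \<open>(-1)^(e, \<delta>)\<close> times \<open>q^(\<delta>\<^sup>T A \<delta> / 2 + (b, \<delta>)) * Q^(A \<delta>)\<close> times the quotients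
  \<open>(q)\<^bsub>x + (p, \<delta>)\<^esub> / (q)\<^sub>x\<close>, where \<open>x = (p, k) + r\<close>, and the inverses of those coming from the
  denominator.\<close>

definition quad_shift :: "summand \<Rightarrow> (nat \<Rightarrow> rat) \<Rightarrow> nat \<Rightarrow> rat" where
  "quad_shift F \<delta> i = (\<Sum>j\<le>nu F. of_int (quad_mat F i j) * \<delta> j)"

text \<open>This quotient is a rational function over the rationals in \<open>q, q^m, q^(k\<^sub>1), \<dots>, q^(k\<^sub>\<nu>)\<close>, and
  numerator and denominator can be read off from it, when its sign is rational, the
  \<open>q\<close>-factorials are shifted by integers, and the exponents of its monomial are integers. Only the
  exponent of \<open>q\<close> itself is allowed to be a half-integer: as \<open>J\<^sub>n\<close> lies in \<open>q^((n-1)/2) \<int>[q, q^(-1)]\<close>,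
  the factor \<open>q^(1/2)\<close> cannot be avoided in \<open>E F / F\<close> with the normalization \<open>J\<^sub>n(unknot) = [n]\<close>. When
  that exponent is an integer, the polynomials below are polynomials in \<open>q\<close>.\<close>

definition rational_shift :: "summand \<Rightarrow> (nat \<Rightarrow> rat) \<Rightarrow> bool" where
  "rational_shift F \<delta> \<longleftrightarrow>
     pair (nu F) (sgn_vec F) \<delta> \<in> \<int> \<and>
     (\<forall>(p, r)\<in>set (num_facs F) \<union> set (den_facs F). pair (nu F) p \<delta> \<in> \<int>) \<and>
     (\<forall>i\<le>nu F. quad_shift F \<delta> i \<in> \<int>) \<and>
     2 * quad_form F \<delta> \<in> \<int>"

definition rational_ratios :: "summand \<Rightarrow> bool" where
  "rational_ratios F \<longleftrightarrow> (\<forall>j\<le>nu F. rational_shift F (shift j))"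

text \<open>Variables \<open>q^(1/2)\<close>, \<open>E\<close> and \<open>Q\<^sub>(\<^sub>0\<^sub>), Q\<^sub>1, \<dots>, Q\<^sub>\<nu>\<close>. The exponent of \<open>q\<close> is doubled accordingly.\<close>

datatype qvar = Qhalf_var | E_var | Q_var nat

fun q_exps :: "rat \<Rightarrow> (nat \<Rightarrow> int) \<Rightarrow> qvar \<Rightarrow> int" where
  "q_exps h u Qhalf_var = \<lfloor>2 * h\<rfloor>"
| "q_exps h u E_var = 0"
| "q_exps h u (Q_var i) = u i"

definition q_vars :: "summand \<Rightarrow> qvar set" where
  "q_vars F = insert Qhalf_var (Q_var ` {..nu F})"

text \<open>\<open>(q)\<^bsub>x + d\<^esub> / (q)\<^sub>x\<close> with \<open>q^x = q^r Q^p\<close>, as factors \<open>1 - q^(r + i) Q^p\<close> with exponents.\<close>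

definition qfact_ratio :: "(nat \<Rightarrow> int) \<Rightarrow> int \<Rightarrow> int \<Rightarrow> ((qvar \<Rightarrow> int) \<times> int) list" where
  "qfact_ratio p r d =
     map (\<lambda>i. (q_exps (of_int (r + i)) p, 1)) [1..d] @
     map (\<lambda>i. (q_exps (of_int (r + i)) p, -1)) [d + 1..0]"

definition diff_facs :: "summand \<Rightarrow> (nat \<Rightarrow> rat) \<Rightarrow> ((qvar \<Rightarrow> int) \<times> int) list" where
  "diff_facs F \<delta> =
     concat (map (\<lambda>(p, r). qfact_ratio p r \<lfloor>pair (nu F) p \<delta>\<rfloor>) (num_facs F)) @
     concat (map (\<lambda>(p, r). map (\<lambda>(f, d). (f, - d)) (qfact_ratio p r \<lfloor>pair (nu F) p \<delta>\<rfloor>))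
       (den_facs F))"

definition diff_mono :: "summand \<Rightarrow> (nat \<Rightarrow> rat) \<Rightarrow> qvar \<Rightarrow> int" where
  "diff_mono F \<delta> = q_exps (quad_form F \<delta>) (\<lambda>i. \<lfloor>quad_shift F \<delta> i\<rfloor>)"

text \<open>\<open>R\<close> and \<open>S\<close> are \<open>diff_R F 0\<close> and \<open>diff_S F 0\<close>; \<open>R\<^sub>j\<close> and \<open>S\<^sub>j\<close> are \<open>diff_R F j\<close> and \<open>diff_S F j\<close>.\<close>

definition diff_R :: "summand \<Rightarrow> nat \<Rightarrow> (qvar, rat) mpol" where
  "diff_R F j = (-1) ^ nat \<lfloor>pair (nu F) (sgn_vec F) (shift j)\<rfloor> *
     read_num (q_vars F) (diff_mono F (shift j)) (diff_facs F (shift j))"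

definition diff_S :: "summand \<Rightarrow> nat \<Rightarrow> (qvar, rat) mpol" where
  "diff_S F j = read_den (q_vars F) (diff_mono F (shift j)) (diff_facs F (shift j))"

text \<open>Evaluation at \<open>q = 1\<close>, followed by the inclusion of \<open>\<rat>[E, Q\<^sub>(\<^sub>0\<^sub>), \<dots>, Q\<^sub>\<nu>]\<close> into the polynomial
  ring over the field of rational functions in \<open>Q\<^sub>(\<^sub>0\<^sub>)\<close>.\<close>

fun qvar_subst :: "qvar \<Rightarrow> (nat, rat poly fract) mpol" where
  "qvar_subst Qhalf_var = 1"
| "qvar_subst E_var = mvar 0"
| "qvar_subst (Q_var i) = (if i = 0 then mconst alpha else mvar i)"

definition eps :: "(qvar, rat) mpol \<Rightarrow> (nat, rat poly fract) mpol" where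
  "eps = msubst rat_const qvar_subst"

definition diff_poly :: "summand \<Rightarrow> nat \<Rightarrow> (nat, rat poly fract) mpol" where
  "diff_poly F j =
     (if j = 0 then eps ((diff_S F 0)\<^sup>2 * (mvar E_var)\<^sup>2 - (diff_R F 0)\<^sup>2)
      else eps (diff_S F j - diff_R F j))"

end

theory Submission
  imports Defs
begin

text \<open>The two systems of generators coincide. A factor \<open>(q)\<^bsub>(p, k) + r\<^esub>\<close> contributes to the ratio of
  a shift by \<open>\<delta>\<close> as many factors \<open>1 - q^h Q^p\<close>, all in the numerator or all in the denominator, as
  \<open>(p, \<delta>)\<close> says, and at \<open>q = 1\<close> they all become \<open>1 - Q^p\<close>. Hence nothing cancels, and \<open>R\<^sub>j\<close>, \<open>S\<^sub>j\<close>
  specialize to \<open>N\<^sub>j\<close>, \<open>D\<^sub>j\<close>. For \<open>j = 0\<close> the shift is by \<open>1/2\<close>, all exponents are halved, and the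
  squares of \<open>R\<close> and \<open>S\<close> specialize to \<open>N\<^sub>0\<close> and \<open>D\<^sub>0\<close>; the sign is no obstacle since rationality of
  the ratio forces \<open>e\<^sub>0\<close> to be even. A coprime generator exists because \<open>\<rat>(\<alpha>)[l]\<close> is a principal ideal
  domain.\<close>

section \<open>Substitution is a ring homomorphism\<close>

text \<open>Monomials outside the support have coefficient 0, which \<open>h\<close> sends to 0.
  This lets several polynomials be summed over one common index set.\<close>

lemma msubst_alt:
  assumes "finite A" "Poly_Mapping.keys P \<subseteq> A" "h 0 = 0"
  shows "msubst h x P = (\<Sum>t\<in>A. h (Poly_Mapping.lookup P t) *
    (\<Prod>v\<in>Poly_Mapping.keys t. x v ^ Poly_Mapping.lookup t v))"
  unfolding msubst_def
  using assms by (intro sum.mono_neutral_left) (auto simp: in_keys_iff)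

text \<open>Over the union of both supports a variable absent from a monomial contributes a zeroth
  power, so exponents simply add.\<close>

lemma monom_value_add:
  fixes x :: "'v \<Rightarrow> 'b::comm_ring_1"
  shows "(\<Prod>v\<in>Poly_Mapping.keys (s + t). x v ^ Poly_Mapping.lookup (s + t) v) =
     (\<Prod>v\<in>Poly_Mapping.keys s. x v ^ Poly_Mapping.lookup s v) *
     (\<Prod>v\<in>Poly_Mapping.keys t. x v ^ Poly_Mapping.lookup t v)"
proof -
  let ?A = "Poly_Mapping.keys s \<union> Poly_Mapping.keys t"
  have ext: "(\<Prod>v\<in>Poly_Mapping.keys u. x v ^ Poly_Mapping.lookup u v) =
      (\<Prod>v\<in>?A. x v ^ Poly_Mapping.lookup u v)" if "Poly_Mapping.keys u \<subseteq> ?A" for u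
    using that by (intro prod.mono_neutral_left) (auto simp: in_keys_iff)
  show ?thesis
    unfolding ext[OF Poly_Mapping.keys_add] ext[of s, OF Un_upper1] ext[of t, OF Un_upper2]
    by (simp add: lookup_add power_add prod.distrib)
qed

lemma poly_mapping_sum_single:
  fixes P :: "'v \<Rightarrow>\<^sub>0 'c::comm_monoid_add"
  shows "P = (\<Sum>t\<in>Poly_Mapping.keys P. Poly_Mapping.single t (Poly_Mapping.lookup P t))"
  by (rule poly_mapping_eqI)
    (simp add: lookup_sum lookup_single when_def in_keys_iff)

locale coeff_hom =
  fixes h :: "'a::comm_ring_1 \<Rightarrow> 'b::comm_ring_1"
  assumes hom_add: "h (a + b) = h a + h b"
    and hom_mult: "h (a * b) = h a * h b"
    and hom_one: "h 1 = 1"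
begin

lemma hom_zero: "h 0 = 0"
  using hom_add[of 0 0] by simp

lemma msubst_single:
  "msubst h x (Poly_Mapping.single t c) =
     h c * (\<Prod>v\<in>Poly_Mapping.keys t. x v ^ Poly_Mapping.lookup t v)"
  by (subst msubst_alt[where A = "{t}"]) (auto simp: hom_zero)

lemma msubst_add: "msubst h x (P + Q) = msubst h x P + msubst h x Q"
proof -
  let ?A = "Poly_Mapping.keys P \<union> Poly_Mapping.keys Q"
  have "msubst h x (P + Q) = (\<Sum>t\<in>?A. h (Poly_Mapping.lookup (P + Q) t) *
      (\<Prod>v\<in>Poly_Mapping.keys t. x v ^ Poly_Mapping.lookup t v))"
    using Poly_Mapping.keys_add[of P Q] by (intro msubst_alt) (auto simp: hom_zero)
  also have "\<dots> = msubst h x P + msubst h x Q"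
    by (simp add: lookup_add hom_add distrib_right sum.distrib msubst_alt[of ?A] hom_zero)
  finally show ?thesis .
qed

lemma msubst_zero: "msubst h x 0 = 0"
  by (simp add: msubst_def)

lemma msubst_one: "msubst h x 1 = 1"
  using msubst_single[of x 0 1] by (simp add: hom_one)

lemma msubst_mvar: "msubst h x (mvar v) = x v"
  by (simp add: mvar_def msubst_single hom_one)

lemma msubst_uminus: "msubst h x (- P) = - msubst h x P"
  using msubst_add[of x P "- P"] by (simp add: msubst_zero eq_neg_iff_add_eq_0 add.commute)

lemma msubst_diff: "msubst h x (P - Q) = msubst h x P - msubst h x Q"
  using msubst_add[of x P "- Q"] by (simp add: msubst_uminus)

lemma msubst_sum: "msubst h x (sum f A) = (\<Sum>i\<in>A. msubst h x (f i))"
  by (induction A rule: infinite_finite_induct) (simp_all add: msubst_zero msubst_add)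

text \<open>By additivity it suffices to multiply single terms, where \<open>monom_value_add\<close>
  and multiplicativity of \<open>h\<close> apply.\<close>

lemma msubst_mult: "msubst h x (P * Q) = msubst h x P * msubst h x Q"
proof -
  let ?s = "\<lambda>P t. Poly_Mapping.single t (Poly_Mapping.lookup P t)"
  have "P * Q = (\<Sum>s\<in>Poly_Mapping.keys P. \<Sum>t\<in>Poly_Mapping.keys Q. ?s P s * ?s Q t)"
    by (simp add: sum_product[symmetric] flip: poly_mapping_sum_single)
  then have "msubst h x (P * Q) =
      (\<Sum>s\<in>Poly_Mapping.keys P. \<Sum>t\<in>Poly_Mapping.keys Q. msubst h x (?s P s * ?s Q t))"
    by (simp add: msubst_sum)
  also have "\<dots> = (\<Sum>s\<in>Poly_Mapping.keys P. \<Sum>t\<in>Poly_Mapping.keys Q.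
      msubst h x (?s P s) * msubst h x (?s Q t))"
    by (simp add: mult_single msubst_single monom_value_add hom_mult mult_ac)
  also have "\<dots> = msubst h x P * msubst h x Q"
    by (simp add: sum_product[symmetric] flip: msubst_sum poly_mapping_sum_single)
  finally show ?thesis .
qed

lemma msubst_power: "msubst h x (P ^ n) = msubst h x P ^ n"
  by (induction n) (simp_all add: msubst_one msubst_mult)

lemma msubst_prod: "msubst h x (prod f A) = (\<Prod>i\<in>A. msubst h x (f i))"
  by (induction A rule: infinite_finite_induct) (simp_all add: msubst_one msubst_mult)

lemma msubst_prod_list: "msubst h x (prod_list Ps) = (\<Prod>P\<leftarrow>Ps. msubst h x P)"
  by (induction Ps) (simp_all add: msubst_one msubst_mult)

lemmas msubst_hom = msubst_zero msubst_one msubst_mvar msubst_uminus msubst_add msubst_diff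
  msubst_mult msubst_power msubst_prod msubst_prod_list

end

section \<open>The embedding of the rational coefficients\<close>

lemma mconst_add: "mconst (a + b) = mconst a + mconst b"
  by (simp add: mconst_def single_add)

lemma mconst_mult: "mconst (a * b) = mconst a * mconst b"
  by (simp add: mconst_def mult_single)

interpretation rat_const: coeff_hom rat_const
proof
  fix a b :: rat
  show "rat_const (a + b) = rat_const a + rat_const b"
    by (simp add: rat_const_def flip: mconst_add to_fract_add)
  show "rat_const (a * b) = rat_const a * rat_const b"
    by (simp add: rat_const_def mult.commute flip: mconst_mult to_fract_mult)
  show "rat_const 1 = 1"
    by (simp add: rat_const_def mconst_def flip: one_pCons)
qed


section \<open>Comparison of the two systems\<close>

text \<open>The common image of \<open>W_var i\<close> and \<open>Q_var i\<close>: the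
  identification of w_i with Q_i, and of \<alpha> with Q_0, takes place here.\<close>

definition base_var :: "nat \<Rightarrow> (nat, rat poly fract) mpol" where
  "base_var i = (if i = 0 then mconst alpha else mvar i)"

text \<open>Since \<open>nat\<close> cuts off negative exponents, \<open>u\<close> and its negative
  give the numerator and the denominator of one Laurent monomial.\<close>

definition base_mono :: "nat \<Rightarrow> (nat \<Rightarrow> int) \<Rightarrow> (nat, rat poly fract) mpol" where
  "base_mono \<nu> u = (\<Prod>i\<le>\<nu>. base_var i ^ nat (u i))"

definition base_binom :: "nat \<Rightarrow> (nat \<Rightarrow> int) \<Rightarrow> (nat, rat poly fract) mpol" where
  "base_binom \<nu> p = base_mono \<nu> (\<lambda>i. - p i) - base_mono \<nu> p"

lemma base_mono_power: "base_mono \<nu> u ^ k = base_mono \<nu> (\<lambda>i. int k * u i)"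
  by (simp add: base_mono_def prod_power_distrib nat_mult_distrib mult.commute flip: power_mult)

lemma lvar_subst_mono:
  "msubst rat_const lvar_subst (mono (W_var ` {..\<nu>}) u) = base_mono \<nu> (\<lambda>i. u (W_var i))"
  by (simp add: mono_def base_mono_def base_var_def rat_const.msubst_hom prod.reindex inj_on_def)

text \<open>The exponent of q^(1/2) disappears because that variable is sent to 1.\<close>

lemma eps_mono: "eps (mono (q_vars F) u) = base_mono (nu F) (\<lambda>i. u (Q_var i))"
proof -
  have "Qhalf_var \<notin> Q_var ` {..nu F}"
    by auto
  then show ?thesis
    by (simp add: eps_def mono_def q_vars_def base_mono_def base_var_def rat_const.msubst_hom
        prod.reindex inj_on_def)
qed

lemma lvar_subst_read:
  fixes \<nu> u fs
  defines "c \<equiv> collected u fs"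
  shows "msubst rat_const lvar_subst (read_num (W_var ` {..\<nu>}) u fs) =
      base_mono \<nu> (\<lambda>i. c (W_var i)) *
      (\<Prod>(p, d)\<leftarrow>fs. base_binom \<nu> (\<lambda>i. p (W_var i)) ^ nat d)"
    and "msubst rat_const lvar_subst (read_den (W_var ` {..\<nu>}) u fs) =
      base_mono \<nu> (\<lambda>i. - c (W_var i)) *
      (\<Prod>(p, d)\<leftarrow>fs. base_binom \<nu> (\<lambda>i. p (W_var i)) ^ nat (- d))"
  by (simp_all add: c_def read_num_def read_den_def binom_fac_def base_binom_def
      rat_const.msubst_hom lvar_subst_mono comp_def case_prod_unfold)

lemma eps_read:
  fixes F u fs
  defines "c \<equiv> collected u fs"
  shows "eps (read_num (q_vars F) u fs) =
      base_mono (nu F) (\<lambda>i. c (Q_var i)) *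
      (\<Prod>(p, d)\<leftarrow>fs. base_binom (nu F) (\<lambda>i. p (Q_var i)) ^ nat d)"
    and "eps (read_den (q_vars F) u fs) =
      base_mono (nu F) (\<lambda>i. - c (Q_var i)) *
      (\<Prod>(p, d)\<leftarrow>fs. base_binom (nu F) (\<lambda>i. p (Q_var i)) ^ nat (- d))"
  by (simp_all add: c_def read_num_def read_den_def binom_fac_def base_binom_def
      rat_const.msubst_hom eps_mono[unfolded eps_def] eps_def comp_def case_prod_unfold)

section \<open>Ratios of q-factorials at q = 1\<close>

text \<open>The factors differ only in their power of q, so all have the same image. The list
  \<open>[1..d]\<close> of length \<open>nat d\<close> enters the numerator, and
  \<open>[d + 1..0]\<close> of length \<open>nat (- d)\<close> the denominator.\<close>

lemma qfact_ratio_prod: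
  "(\<Prod>(f, d')\<leftarrow>qfact_ratio p r d. base_binom \<nu> (\<lambda>i. f (Q_var i)) ^ nat d') = base_binom \<nu> p ^ nat d"
  "(\<Prod>(f, d')\<leftarrow>qfact_ratio p r d. base_binom \<nu> (\<lambda>i. f (Q_var i)) ^ nat (- d')) =
     base_binom \<nu> p ^ nat (- d)"
  by (simp_all add: qfact_ratio_def comp_def map_replicate_const)

text \<open>The signed count of the factors is \<open>nat d - nat (- d)\<close>, which is
  \<open>d\<close>.\<close>

lemma qfact_ratio_sum:
  "(\<Sum>(f, d')\<leftarrow>qfact_ratio p r d. d' * g (\<lambda>i. f (Q_var i))) = d * g p"
  by (simp add: qfact_ratio_def comp_def map_replicate_const sum_list_replicate)

lemma prod_list_concat_map:
  "prod_list (map g (concat (map f xs))) = (\<Prod>x\<leftarrow>xs. prod_list (map g (f x)))"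
  by (induction xs) auto

lemma sum_list_concat_map:
  "sum_list (map g (concat (map f xs))) = (\<Sum>x\<leftarrow>xs. sum_list (map g (f x)))"
  by (induction xs) auto

lemma prod_list_power:
  fixes f :: "'a \<Rightarrow> 'b::comm_monoid_mult"
  shows "prod_list (map f xs) ^ k = (\<Prod>x\<leftarrow>xs. f x ^ k)"
  by (induction xs) (auto simp: power_mult_distrib)

section \<open>Clearing the denominator of the shift\<close>

text \<open>The denominator of the nonzero entry of \<open>shift j\<close>; it is also the power to
  which R_j and S_j are raised in the generators.\<close>

definition shift_denom :: "nat \<Rightarrow> nat" where
  "shift_denom j = (if j = 0 then 2 else 1)"

lemma shift_sum:
  assumes "j \<le> \<nu>"
  shows "of_nat (shift_denom j) * (\<Sum>i\<le>\<nu>. of_int (p i) * shift j i) = of_int (p j)"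
proof -
  have "(\<Sum>i\<le>\<nu>. of_int (p i) * shift j i) = of_int (p j) * shift j j"
    using assms by (subst sum.remove[of _ j]) (auto simp: shift_def intro!: sum.neutral)
  then show ?thesis
    by (simp add: shift_denom_def shift_def)
qed

text \<open>The floor is exact on an integral \<open>x\<close>, so the rational identity descends to
  the integers.\<close>

lemma floor_shift:
  fixes x :: rat
  assumes "of_nat k * x = of_int z" "x \<in> \<int>"
  shows "int k * \<lfloor>x\<rfloor> = z"
proof -
  from assms(2) obtain y where "x = of_int y"
    by (auto elim: Ints_cases)
  with assms(1) show ?thesis
    by (simp flip: of_int_eq_iff[where ?'a = rat])
qed

text \<open>Each 1 - Q^p takes Q^(p^-) out as a denominator, and the signed number of such factors
  is the pairing with the shift. The result has the same shape as \<open>collected_pot\<close>, with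
  that pairing in place of \<open>p j\<close>.\<close>

lemma collected_diff:
  "collected (diff_mono F \<delta>) (diff_facs F \<delta>) (Q_var i) =
     \<lfloor>quad_shift F \<delta> i\<rfloor>
     - (\<Sum>(p, r)\<leftarrow>num_facs F. \<lfloor>pair (nu F) p \<delta>\<rfloor> * max 0 (- p i))
     + (\<Sum>(p, r)\<leftarrow>den_facs F. \<lfloor>pair (nu F) p \<delta>\<rfloor> * max 0 (- p i))"
proof -
  have "(\<Sum>(f, d')\<leftarrow>qfact_ratio p r d. d' * max 0 (- f (Q_var i))) = d * max 0 (- p i)" for p r d
    by (rule qfact_ratio_sum)
  \<comment> \<open>This form serves the factors of \<open>den_facs F\<close>, whose exponents are
    negated.\<close>
  moreover from this
  have "(\<Sum>(f, d')\<leftarrow>qfact_ratio p r d. - (d' * max 0 (- f (Q_var i)))) = - (d * max 0 (- p i))" for p r d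
    by (simp add: case_prod_unfold flip: uminus_sum_list_map[unfolded comp_def])
  ultimately show ?thesis
    by (simp add: collected_def diff_mono_def diff_facs_def sum_list_concat_map case_prod_unfold
        comp_def flip: uminus_sum_list_map[unfolded comp_def])
qed

lemma collected_pot:
  "collected (w_exps (\<lambda>i. quad_mat F i j)) (pot_facs F j) (W_var i) =
     quad_mat F i j
     - (\<Sum>(p, r)\<leftarrow>num_facs F. p j * max 0 (- p i))
     + (\<Sum>(p, r)\<leftarrow>den_facs F. p j * max 0 (- p i))"
  by (simp add: collected_def pot_facs_def case_prod_unfold comp_def
      flip: uminus_sum_list_map[unfolded comp_def])

lemma diff_facs_prod:
  "(\<Prod>(f, d)\<leftarrow>diff_facs F \<delta>. base_binom \<nu> (\<lambda>i. f (Q_var i)) ^ nat d) =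
     (\<Prod>(p, r)\<leftarrow>num_facs F. base_binom \<nu> p ^ nat \<lfloor>pair (nu F) p \<delta>\<rfloor>) *
     (\<Prod>(p, r)\<leftarrow>den_facs F. base_binom \<nu> p ^ nat (- \<lfloor>pair (nu F) p \<delta>\<rfloor>))"
  "(\<Prod>(f, d)\<leftarrow>diff_facs F \<delta>. base_binom \<nu> (\<lambda>i. f (Q_var i)) ^ nat (- d)) =
     (\<Prod>(p, r)\<leftarrow>num_facs F. base_binom \<nu> p ^ nat (- \<lfloor>pair (nu F) p \<delta>\<rfloor>)) *
     (\<Prod>(p, r)\<leftarrow>den_facs F. base_binom \<nu> p ^ nat \<lfloor>pair (nu F) p \<delta>\<rfloor>)"
  using qfact_ratio_prod[of \<nu>]
  by (simp_all add: diff_facs_def prod_list_concat_map case_prod_unfold comp_def)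

lemma pot_facs_prod:
  "(\<Prod>(f, d)\<leftarrow>pot_facs F j. base_binom \<nu> (\<lambda>i. f (W_var i)) ^ nat d) =
     (\<Prod>(p, r)\<leftarrow>num_facs F. base_binom \<nu> p ^ nat (p j)) *
     (\<Prod>(p, r)\<leftarrow>den_facs F. base_binom \<nu> p ^ nat (- p j))"
  "(\<Prod>(f, d)\<leftarrow>pot_facs F j. base_binom \<nu> (\<lambda>i. f (W_var i)) ^ nat (- d)) =
     (\<Prod>(p, r)\<leftarrow>num_facs F. base_binom \<nu> p ^ nat (- p j)) *
     (\<Prod>(p, r)\<leftarrow>den_facs F. base_binom \<nu> p ^ nat (p j))"
  by (simp_all add: pot_facs_def case_prod_unfold comp_def)

text \<open>Multiplication by k = \<open>shift_denom j\<close> carries every exponent of the ratio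
  at q = 1 to the corresponding exponent of the potential equation. As k is positive, positive and
  negative parts scale separately, so taking k-th powers respects the split into numerator and
  denominator.\<close>

lemma eps_diff_RS_power:
  assumes "rational_shift F (shift j)" "j \<le> nu F"
  shows "eps (diff_R F j) ^ shift_denom j = msubst rat_const lvar_subst (pot_N F j)"
    and "eps (diff_S F j) ^ shift_denom j = msubst rat_const lvar_subst (pot_D F j)"
proof -
  define \<delta> where "\<delta> = shift j"
  define k where "k = shift_denom j"
  let ?d = "\<lambda>p. \<lfloor>pair (nu F) p \<delta>\<rfloor>"
  let ?a = "\<lambda>i. \<lfloor>quad_shift F \<delta> i\<rfloor>"
  have d: "int k * ?d p = p j" if "pair (nu F) p \<delta> \<in> \<int>" for p
    using shift_sum[OF assms(2), of p] that unfolding \<delta>_def k_def pair_def by (rule floor_shift)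
  have facs: "int k * ?d (fst f) = fst f j" if "f \<in> set (num_facs F) \<union> set (den_facs F)" for f
  proof (rule d)
    show "pair (nu F) (fst f) \<delta> \<in> \<int>"
      using assms(1) that by (auto simp: rational_shift_def \<delta>_def case_prod_unfold)
  qed
  have a: "int k * ?a i = quad_mat F i j" if "i \<le> nu F" for i
    using shift_sum[OF assms(2), of "quad_mat F i"] assms(1) that
    unfolding \<delta>_def k_def quad_shift_def rational_shift_def by (intro floor_shift) auto
  \<comment> \<open>For \<open>j = 0\<close> integrality of the pairing makes e_0 twice an integer,
    so squaring the sign of R gives exactly the sign of N_0.\<close>
  have sgn: "k * nat (?d (sgn_vec F)) = nat (sgn_vec F j)"
  proof -
    have "int k * ?d (sgn_vec F) = sgn_vec F j"
      using assms(1) by (intro d) (simp add: rational_shift_def \<delta>_def)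
    from this[symmetric] show ?thesis
      by (simp add: nat_mult_distrib)
  qed
  \<comment> \<open>The two halves record that a factor stays on its side of the fraction: the
    truncated exponents scale by \<open>k\<close> whatever their sign.\<close>
  have nat_d: "nat (?d (fst f)) * k = nat (fst f j)" "nat (- ?d (fst f)) * k = nat (- fst f j)"
    if "f \<in> set (num_facs F) \<union> set (den_facs F)" for f
    using facs[OF that, symmetric] by (simp_all add: nat_mult_distrib flip: mult_minus_right)
  \<comment> \<open>The collected exponent is linear in the pairings with the shift, so it scales
    before any truncation by \<open>nat\<close>.\<close>
  have coll: "int k * collected (diff_mono F \<delta>) (diff_facs F \<delta>) (Q_var i) =
      collected (w_exps (\<lambda>i. quad_mat F i j)) (pot_facs F j) (W_var i)" if "i \<le> nu F" for i
  proof -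
    have "int k * (\<Sum>(p, r)\<leftarrow>fs. ?d p * max 0 (- p i)) = (\<Sum>(p, r)\<leftarrow>fs. p j * max 0 (- p i))"
      if "set fs \<subseteq> set (num_facs F) \<union> set (den_facs F)" for fs
      using facs[OF subsetD[OF that]]
      by (auto simp: case_prod_unfold sum_list_const_mult[symmetric] mult.assoc[symmetric]
          intro!: arg_cong[where f = sum_list] map_cong)
    then show ?thesis
      using a[OF that] by (simp add: collected_diff collected_pot distrib_left right_diff_distrib)
  qed
  have mono: "base_mono (nu F) (\<lambda>i. collected (diff_mono F \<delta>) (diff_facs F \<delta>) (Q_var i)) ^ k =
      base_mono (nu F) (\<lambda>i. collected (w_exps (\<lambda>i. quad_mat F i j)) (pot_facs F j) (W_var i))"
    "base_mono (nu F) (\<lambda>i. - collected (diff_mono F \<delta>) (diff_facs F \<delta>) (Q_var i)) ^ k =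
      base_mono (nu F) (\<lambda>i. - collected (w_exps (\<lambda>i. quad_mat F i j)) (pot_facs F j) (W_var i))"
    unfolding base_mono_power by (auto simp: base_mono_def coll intro!: prod.cong)
  have prods: "(\<Prod>(p, r)\<leftarrow>fs. base_binom (nu F) p ^ nat (?d p)) ^ k =
      (\<Prod>(p, r)\<leftarrow>fs. base_binom (nu F) p ^ nat (p j))"
    "(\<Prod>(p, r)\<leftarrow>fs. base_binom (nu F) p ^ nat (- ?d p)) ^ k =
      (\<Prod>(p, r)\<leftarrow>fs. base_binom (nu F) p ^ nat (- p j))"
    if "set fs \<subseteq> set (num_facs F) \<union> set (den_facs F)" for fs
    using nat_d[OF subsetD[OF that]]
    by (auto simp: prod_list_power case_prod_unfold power_mult[symmetric]
        intro!: arg_cong[where f = prod_list] map_cong)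
  have "eps (diff_R F j) = (-1) ^ nat (?d (sgn_vec F)) *
      eps (read_num (q_vars F) (diff_mono F \<delta>) (diff_facs F \<delta>))"
    by (simp add: diff_R_def eps_def rat_const.msubst_hom \<delta>_def)
  also have "\<dots> ^ k = msubst rat_const lvar_subst (pot_N F j)"
    by (simp add: pot_N_def rat_const.msubst_hom eps_read lvar_subst_read power_mult_distrib
        mono prods diff_facs_prod pot_facs_prod sgn mult.commute[of _ k] flip: power_mult)
  finally show "eps (diff_R F j) ^ shift_denom j = msubst rat_const lvar_subst (pot_N F j)"
    by (simp add: k_def)
  have "eps (diff_S F j) ^ k = msubst rat_const lvar_subst (pot_D F j)"
    by (simp add: pot_D_def diff_S_def eps_read lvar_subst_read power_mult_distrib
        mono prods diff_facs_prod pot_facs_prod flip: \<delta>_def)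
  then show "eps (diff_S F j) ^ shift_denom j = msubst rat_const lvar_subst (pot_D F j)"
    by (simp add: k_def)
qed

lemma diff_poly_eq_pot_poly:
  assumes "rational_ratios F" "j \<le> nu F"
  shows "diff_poly F j = pot_poly F j"
proof -
  have "rational_shift F (shift j)"
    using assms by (simp add: rational_ratios_def)
  note RS = eps_diff_RS_power[OF this assms(2)]
  show ?thesis
  proof (cases "j = 0")
    case True
    \<comment> \<open>Here the power is 2, and E and l are both variable 0, so S^2 E^2 - R^2 becomes
      D_0 l^2 - N_0.\<close>
    with RS show ?thesis
      by (simp add: diff_poly_def pot_poly_def shift_denom_def eps_def rat_const.msubst_hom)
  next
    case False
    with RS show ?thesis
      by (simp add: diff_poly_def pot_poly_def shift_denom_def eps_def rat_const.msubst_hom)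
  qed
qed

lemma elim_ideal_cong:
  assumes "\<And>j. j \<le> \<nu> \<Longrightarrow> P j = Q j"
  shows "elim_ideal \<nu> P = elim_ideal \<nu> Q"
proof -
  have "(\<Sum>j\<le>\<nu>. c j * P j) = (\<Sum>j\<le>\<nu>. c j * Q j)" for c
    using assms by (intro sum.cong) auto
  then show ?thesis
    by (simp add: elim_ideal_def ideal_gen_def)
qed


section \<open>Existence of the coprime generator\<close>

lemma mpols_mconst: "mconst c \<in> mpols \<nu>"
  by (auto simp: mpols_def mconst_def)

lemma mpols_mvar: "v \<le> \<nu> \<Longrightarrow> mvar v \<in> mpols \<nu>"
  by (auto simp: mpols_def mvar_def)

lemma mpols_add:
  assumes "P \<in> mpols \<nu>" "Q \<in> mpols \<nu>"
  shows "P + Q \<in> mpols \<nu>"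
  using assms Poly_Mapping.keys_add[of P Q] unfolding mpols_def by blast

lemma mpols_mult:
  assumes "P \<in> mpols \<nu>" "Q \<in> mpols \<nu>"
  shows "P * Q \<in> mpols \<nu>"
  unfolding mpols_def
proof safe
  fix t v
  assume "t \<in> Poly_Mapping.keys (P * Q)" "v \<in> Poly_Mapping.keys t"
  then obtain a b where "a \<in> Poly_Mapping.keys P" "b \<in> Poly_Mapping.keys Q" "t = a + b"
    using Poly_Mapping.keys_mult[of P Q] by blast
  moreover from this have "v \<in> Poly_Mapping.keys a \<union> Poly_Mapping.keys b"
    using \<open>v \<in> Poly_Mapping.keys t\<close> Poly_Mapping.keys_add[of a b] by blast
  ultimately show "v \<le> \<nu>"
    using assms unfolding mpols_def by blast
qed

lemma ideal_gen_zero: "0 \<in> ideal_gen \<nu> P"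
  by (auto simp: ideal_gen_def mpols_def intro!: exI[of _ "\<lambda>_. 0"])

lemma ideal_gen_add:
  assumes "x \<in> ideal_gen \<nu> P" "y \<in> ideal_gen \<nu> P"
  shows "x + y \<in> ideal_gen \<nu> P"
proof -
  from assms obtain c d where "\<forall>j\<le>\<nu>. c j \<in> mpols \<nu>" "x = (\<Sum>j\<le>\<nu>. c j * P j)"
    "\<forall>j\<le>\<nu>. d j \<in> mpols \<nu>" "y = (\<Sum>j\<le>\<nu>. d j * P j)"
    unfolding ideal_gen_def by blast
  then show ?thesis
    unfolding ideal_gen_def
    by (auto intro!: exI[of _ "\<lambda>j. c j + d j"] mpols_add simp: distrib_right sum.distrib)
qed

lemma ideal_gen_mult:
  assumes "x \<in> ideal_gen \<nu> P" "z \<in> mpols \<nu>"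
  shows "z * x \<in> ideal_gen \<nu> P"
proof -
  from assms(1) obtain c where "\<forall>j\<le>\<nu>. c j \<in> mpols \<nu>" "x = (\<Sum>j\<le>\<nu>. c j * P j)"
    unfolding ideal_gen_def by blast
  then show ?thesis
    using assms(2) unfolding ideal_gen_def
    by (auto intro!: exI[of _ "\<lambda>j. z * c j"] mpols_mult simp: sum_distrib_left mult.assoc)
qed

lemma mconst_zero: "mconst 0 = 0"
  by (simp add: mconst_def)

lemma map_poly_mconst_add:
  "map_poly mconst (f + g) = map_poly mconst f + map_poly mconst g"
  by (rule poly_eqI) (simp add: coeff_map_poly mconst_zero mconst_add)

lemma map_poly_mconst_smult:
  "map_poly mconst (Polynomial.smult c f) = Polynomial.smult (mconst c) (map_poly mconst f)"
  by (simp add: map_poly_smult mconst_zero mconst_mult)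

lemma elim_ideal_zero: "0 \<in> elim_ideal \<nu> P"
  by (simp add: elim_ideal_def ideal_gen_zero)

lemma elim_ideal_add:
  "f \<in> elim_ideal \<nu> P \<Longrightarrow> g \<in> elim_ideal \<nu> P \<Longrightarrow> f + g \<in> elim_ideal \<nu> P"
  by (simp add: elim_ideal_def ideal_gen_add map_poly_mconst_add)

text \<open>Induction on the multiplier reduces the claim to multiplication by a constant and by the
  polynomial variable. These act on the ambient ideal as \<open>mconst a\<close> and
  \<open>mvar 0\<close>, both in \<open>mpols \<nu>\<close>.\<close>

lemma elim_ideal_mult:
  assumes "f \<in> elim_ideal \<nu> P"
  shows "g * f \<in> elim_ideal \<nu> P"
proof (induction g)
  case 0
  then show ?case
    by (simp add: elim_ideal_zero)
next
  case (pCons a g)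
  have "Polynomial.smult a f \<in> elim_ideal \<nu> P"
    using assms by (simp add: elim_ideal_def map_poly_mconst_smult ideal_gen_mult mpols_mconst)
  moreover have "pCons 0 (g * f) \<in> elim_ideal \<nu> P"
    using pCons.IH
    by (simp add: elim_ideal_def map_poly_pCons mconst_zero ideal_gen_mult mpols_mvar)
  ultimately show ?case
    by (simp add: elim_ideal_add)
qed

section \<open>Principal ideals in one variable\<close>

text \<open>Division with remainder: a nonzero element of least degree generates, and the zero ideal
  is generated by 0.\<close>

lemma poly_ideal_principal:
  fixes I :: "'a::field poly set"
  assumes zero: "0 \<in> I" and add: "\<And>f g. f \<in> I \<Longrightarrow> g \<in> I \<Longrightarrow> f + g \<in> I"
    and mult: "\<And>f g. f \<in> I \<Longrightarrow> g * f \<in> I"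
  obtains g where "I = {f. g dvd f}"
proof (cases "I \<subseteq> {0}")
  case True
  with zero have "I = {f. 0 dvd f}"
    by auto
  then show ?thesis
    by (rule that)
next
  case False
  then obtain g where g: "g \<in> I - {0}" and least: "\<And>f. f \<in> I - {0} \<Longrightarrow> Polynomial.degree g \<le> Polynomial.degree f"
    using ex_has_least_nat[of "\<lambda>f. f \<in> I - {0}" _ Polynomial.degree] by blast
  have "g dvd f" if "f \<in> I" for f
  proof -
    have "f mod g = f + (- (f div g)) * g"
      by (simp add: minus_div_mult_eq_mod[symmetric])
    then have "f mod g \<in> I"
      using that g add mult by (metis DiffD1)
    \<comment> \<open>A nonzero remainder would be a member of \<open>I\<close> of smaller degree
      than \<open>g\<close>.\<close>
    then have "f mod g = 0"
      using least[of "f mod g"] g degree_mod_less[of g f] by force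
    then show ?thesis
      by auto
  qed
  then have "I = {f. g dvd f}"
    using g mult[of g] by (auto elim!: dvdE simp: mult.commute[of g])
  then show ?thesis
    by (rule that)
qed

section \<open>Clearing denominators and passing to coprime coefficients\<close>

definition int_to_fract :: "int poly \<Rightarrow> rat poly fract" where
  "int_to_fract c = to_fract (map_poly of_int c)"

lemma map_poly_of_int_mult:
  "map_poly of_int (p * q) = map_poly of_int p * (map_poly of_int q :: 'a::comm_ring_1 poly)"
  by (rule poly_eqI) (simp add: coeff_map_poly coeff_mult)

lemma int_to_fract_mult: "int_to_fract (a * b) = int_to_fract a * int_to_fract b"
  by (simp add: int_to_fract_def map_poly_of_int_mult)

lemma int_to_fract_0: "int_to_fract 0 = 0"
  by (simp add: int_to_fract_def)

lemma int_to_fract_eq_0_iff: "int_to_fract a = 0 \<longleftrightarrow> a = 0"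
  by (simp add: int_to_fract_def map_poly_eq_0_iff)

lemma to_Q_alpha_smult:
  "to_Q_alpha (Polynomial.smult c a) = Polynomial.smult (int_to_fract c) (to_Q_alpha a)"
  unfolding to_Q_alpha_def int_to_fract_def[symmetric]
  by (simp add: map_poly_smult int_to_fract_mult int_to_fract_0)

lemma to_Q_alpha_pCons: "to_Q_alpha (pCons c a) = pCons (int_to_fract c) (to_Q_alpha a)"
  unfolding to_Q_alpha_def int_to_fract_def[symmetric]
  by (simp add: map_poly_pCons int_to_fract_0)

lemma to_Q_alpha_0: "to_Q_alpha 0 = 0"
  by (simp add: to_Q_alpha_def)

lemma clear_denominators_rat:
  fixes p :: "rat poly"
  obtains c :: int and a :: "int poly" where "c \<noteq> 0" "map_poly of_int a = Polynomial.smult (of_int c) p"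
proof -
  have "\<exists>c a. c \<noteq> 0 \<and> map_poly of_int a = Polynomial.smult (of_int c) p" for p :: "rat poly"
  proof (induction p)
    case 0
    show ?case
      by (rule exI[of _ 1], rule exI[of _ 0]) simp
  next
    case (pCons x p)
    then obtain c a where c: "c \<noteq> 0" "map_poly of_int a = Polynomial.smult (of_int c) p"
      by blast
    obtain u v where x: "x = of_int u / of_int v" "v \<noteq> 0"
      by (metis Fract_of_int_quotient Rat_cases less_irrefl)
    \<comment> \<open>The denominator \<open>v\<close> of the new coefficient is multiplied onto
      \<open>c\<close>: the new coefficient becomes c v x = c u, and the old ones are rescaled by
      \<open>v\<close>.\<close>
    have "map_poly of_int (pCons (c * u) (Polynomial.smult v a)) = Polynomial.smult (of_int (c * v)) (pCons x p)"
      using x c by (simp add: map_poly_pCons map_poly_smult mult.commute)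
    then show ?case
      using c x by (metis mult_eq_0_iff)
  qed
  then show ?thesis
    using that by blast
qed

lemma rat_poly_fract_quotient:
  obtains u v :: "int poly" where "v \<noteq> 0" "int_to_fract v * x = int_to_fract u"
proof -
  obtain p q where x: "x = to_fract p / to_fract q" "q \<noteq> 0"
    by (metis Fract_conv_to_fract Fract_cases)
  obtain c a where a: "c \<noteq> 0" "map_poly of_int a = Polynomial.smult (of_int c) p"
    by (rule clear_denominators_rat)
  obtain d b where b: "d \<noteq> 0" "map_poly of_int b = Polynomial.smult (of_int d) q"
    by (rule clear_denominators_rat)
  have "to_fract (Polynomial.smult k q) * x = to_fract (Polynomial.smult k p)" for k
  proof -
    have "to_fract (Polynomial.smult k r) = to_fract [:k:] * to_fract r" for r
      by (simp flip: to_fract_mult)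
    with x show ?thesis
      by simp
  qed
  \<comment> \<open>With x = p/q, the crossed multipliers yield c d q and c d p, so the common
    factor c d leaves the quotient unchanged.\<close>
  then have "int_to_fract (Polynomial.smult c b) * x = int_to_fract (Polynomial.smult d a)"
    using a b by (simp add: int_to_fract_def map_poly_smult mult.commute)
  moreover have "Polynomial.smult c b \<noteq> 0"
    using a b x by auto
  ultimately show ?thesis
    using that by blast
qed

text \<open>The induction of \<open>clear_denominators_rat\<close> one level up, with integer
  polynomials in \<alpha> as the denominators.\<close>

lemma clear_denominators:
  obtains c :: "int poly" and a :: "int poly poly"
    where "c \<noteq> 0" "to_Q_alpha a = Polynomial.smult (int_to_fract c) f"
proof -
  have "\<exists>c a. c \<noteq> 0 \<and> to_Q_alpha a = Polynomial.smult (int_to_fract c) f"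
  proof (induction f)
    case 0
    show ?case
      by (rule exI[of _ 1], rule exI[of _ 0]) (simp add: to_Q_alpha_0)
  next
    case (pCons x f)
    then obtain c a where c: "c \<noteq> 0" "to_Q_alpha a = Polynomial.smult (int_to_fract c) f"
      by blast
    obtain u v where x: "v \<noteq> 0" "int_to_fract v * x = int_to_fract u"
      by (rule rat_poly_fract_quotient)
    have "to_Q_alpha (pCons (c * u) (Polynomial.smult v a)) = Polynomial.smult (int_to_fract (c * v)) (pCons x f)"
      using x c
      by (simp add: to_Q_alpha_pCons to_Q_alpha_smult int_to_fract_mult mult_ac flip: x(2))
    then show ?case
      using c x by (metis mult_eq_0_iff)
  qed
  then show ?thesis
    using that by blast
qed

text \<open>The cleared denominator and the content are nonzero, hence units of the field of
  rational functions. So removing them changes \<open>f\<close> only by a unit.\<close>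

lemma primitive_associate:
  obtains a where "to_Q_alpha a dvd f" "f dvd to_Q_alpha a" "a = 0 \<or> content a = 1"
proof (cases "f = 0")
  case True
  then show ?thesis
    using that[of 0] by (simp add: to_Q_alpha_0)
next
  case False
  obtain c a where c: "c \<noteq> 0" "to_Q_alpha a = Polynomial.smult (int_to_fract c) f"
    by (rule clear_denominators)
  with False have "a \<noteq> 0"
    by (auto simp: to_Q_alpha_0 int_to_fract_eq_0_iff)
  have "to_Q_alpha a = Polynomial.smult (int_to_fract (content a)) (to_Q_alpha (primitive_part a))"
    by (simp flip: to_Q_alpha_smult)
  then have eq: "Polynomial.smult (int_to_fract c) f =
      Polynomial.smult (int_to_fract (content a)) (to_Q_alpha (primitive_part a))"
    using c by simp
  have nz: "int_to_fract c \<noteq> 0" "int_to_fract (content a) \<noteq> 0"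
    using c \<open>a \<noteq> 0\<close> by (simp_all add: int_to_fract_eq_0_iff)
  have "to_Q_alpha (primitive_part a) dvd f" "f dvd to_Q_alpha (primitive_part a)"
    using nz eq by (metis dvd_refl dvd_smult_iff smult_dvd_iff)+
  then show ?thesis
    using that[of "primitive_part a"] \<open>a \<noteq> 0\<close> by (simp add: content_primitive_part)
qed

lemma ex_coprime_generator: "\<exists>g. coprime_generator (elim_ideal \<nu> P) g"
proof -
  obtain g where g: "elim_ideal \<nu> P = {f. g dvd f}"
    using poly_ideal_principal[OF elim_ideal_zero elim_ideal_add elim_ideal_mult] .
  obtain a where a: "to_Q_alpha a dvd g" "g dvd to_Q_alpha a" "a = 0 \<or> content a = 1"
    by (rule primitive_associate)
  \<comment> \<open>Associated polynomials have the same multiples.\<close>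
  then have "elim_ideal \<nu> P = {f. to_Q_alpha a dvd f}"
    unfolding g by (blast intro: dvd_trans)
  with a show ?thesis
    by (auto simp: coprime_generator_def)
qed

theorem corollary5p2:
  fixes K :: "(real^3) set" and F :: summand
  assumes "hyperbolic_knot K"
    and "summand_of_colored_jones F K"
    and "rational_ratios F"
    and "solvable F"
  shows "(\<exists>g. coprime_generator (elim_ideal (nu F) (diff_poly F)) g) \<and>
    (\<forall>a. is_a_F F a \<longleftrightarrow> coprime_generator (elim_ideal (nu F) (diff_poly F)) a)"
proof -
  \<comment> \<open>The ideals agree because their generators agree one by one, so both sides of the
    equivalence speak of the same generators.\<close>
  have "elim_ideal (nu F) (diff_poly F) = elim_ideal (nu F) (pot_poly F)"
    using assms(3) by (intro elim_ideal_cong diff_poly_eq_pot_poly)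
  then show ?thesis
    by (simp add: is_a_F_def ex_coprime_generator)
qed

end
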